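(* Let $(\varphi,\xi,\eta,g)$ be a para-Kenmotsu structure on the $(2n+1)$-dimensional manifold $M$, let $(g,\xi,\lambda,\mu)$ be an $\eta$-Ricci soliton on $M$, and suppose that $(\xi,\cdot)_{W_2}\cdot S=0$, i.e. $$S(W_2(\xi,X)Y,Z)+S(Y,W_2(\xi,X)Z)=0$$ for all vector fields $X,Y,Z$ on $M$. Then either $\mu=1$ and $\lambda=2n-1$, or $\mu=2n+1$ and $\lambda=-1$.
   Context: Here $n\geq 1$. An almost paracontact metric structure on a $(2n+1)$-dimensional smooth manifold $M$ is $(\varphi,\xi,\eta,g)$, where $\varphi$ is a $(1,1)$-tensor field, $\xi$ a vector field, $\eta$ a $1$-form and $g$ a pseudo-Riemannian metric of signature $(n+1,n)$, such that: (1) $\varphi\xi=0$, $\eta\circ\varphi=0$; (2) $\eta(\xi)=1$, $\varphi^2=I-\eta\otimes\xi$; (3) $\varphi$ induces on the $2n$-dimensional distribution $\mathcal{D}=\ker\eta$ an almost paracomplex structure $P$, i.e. $P^2=I$ on $\mathcal{D}$ and the eigensubbundles of $P$ for the eigenvalues $1$ and $-1$ both have rank $n$; (4) $g(\varphi X,\varphi Y)=-g(X,Y)+\eta(X)\eta(Y)$ for all vector fields $X,Y$. It follows that $\eta(X)=g(X,\xi)$. The structure is para-Kenmotsu if the Levi-Civita connection $\nabla$ of $g$ satisfies $(\nabla_X\varphi)Y=g(\varphi X,Y)\xi-\eta(Y)\varphi X$ for all vector fields $X,Y$. $R(X,Y)Z=\nabla_X\nabla_YZ-\nabla_Y\nabla_XZ-\nabla_{[X,Y]}Z$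 is the Riemann curvature tensor, $S(Y,Z)=\operatorname{trace}(X\mapsto R(X,Y)Z)$ is the Ricci curvature tensor of $g$, $Q$ is the Ricci operator defined by $g(QX,Y)=S(X,Y)$, and $L_\xi$ is the Lie derivative along $\xi$. The $W_2$-curvature tensor field is $W_2(X,Y)Z:=R(X,Y)Z+\frac{1}{2n}[g(X,Z)QY-g(Y,Z)QX]$. The data $(g,\xi,\lambda,\mu)$, with $\lambda,\mu$ real constants, is an $\eta$-Ricci soliton on $M$ if $L_{\xi}g+2S+2\lambda g+2\mu\,\eta\otimes\eta=0$. *)

theory Defs
  imports "HOL-Analysis.Analysis"
begin

section \<open>Smooth maps between Euclidean spaces\<close>

(* Meaningful for open S.  At order k+1 all directional derivatives have to be of class C^k. *)
fun Ck_on :: "nat \<Rightarrow> ('v::real_normed_vector \<Rightarrow> 'w::real_normed_vector) \<Rightarrow> 'v set \<Rightarrow> bool" where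
  "Ck_on 0 f S \<longleftrightarrow> continuous_on S f"
| "Ck_on (Suc k) f S \<longleftrightarrow>
     (\<forall>x\<in>S. f differentiable (at x)) \<and>
     (\<forall>v. Ck_on k (\<lambda>x. frechet_derivative f (at x) v) S)"

definition smooth_on :: "('v::real_normed_vector \<Rightarrow> 'w::real_normed_vector) \<Rightarrow> 'v set \<Rightarrow> bool" where
  "smooth_on f S \<longleftrightarrow> (\<forall>k. Ck_on k f S)"

section \<open>Smooth manifolds\<close>

(* The points of the manifold are the elements of a Hausdorff, second countable type 'a.
   A chart is a pair (domain, coordinate map); its dimension is CARD('m). *)
type_synonym ('a, 'm) chart = "'a set \<times> ('a \<Rightarrow> real ^ 'm)"

abbreviation cdom :: "('a, 'm::finite) chart \<Rightarrow> 'a set" where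
  "cdom c \<equiv> fst c"

abbreviation cmap :: "('a, 'm::finite) chart \<Rightarrow> 'a \<Rightarrow> real ^ 'm" where
  "cmap c \<equiv> snd c"

abbreviation cran :: "('a, 'm::finite) chart \<Rightarrow> (real ^ 'm) set" where
  "cran c \<equiv> cmap c ` cdom c"

definition cinv :: "('a, 'm::finite) chart \<Rightarrow> real ^ 'm \<Rightarrow> 'a" where
  "cinv c = inv_into (cdom c) (cmap c)"

definition chart_change :: "('a, 'm::finite) chart \<Rightarrow> ('a, 'm) chart \<Rightarrow> real ^ 'm \<Rightarrow> real ^ 'm" where
  "chart_change c d = cmap d \<circ> cinv c"

definition smooth_atlas ::
  "('a::{t2_space,second_countable_topology}, 'm::finite) chart set \<Rightarrow> bool" where
  "smooth_atlas A \<longleftrightarrow>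
     (\<Union>c\<in>A. cdom c) = UNIV \<and>
     (\<forall>c\<in>A. open (cdom c) \<and> open (cran c) \<and>
        homeomorphism (cdom c) (cran c) (cmap c) (cinv c)) \<and>
     (\<forall>c\<in>A. \<forall>d\<in>A. smooth_on (chart_change c d) (cmap c ` (cdom c \<inter> cdom d)))"

section \<open>Tangent vectors\<close>

(* The tangent space at p is modelled as real^'m by means of a chart around p chosen once and
   for all: v :: real^'m stands for the tangent vector at p having components v in the chart
   "chart_at A p".  Components in another chart c are obtained by the usual transformation law,
   that is, by the Jacobian of the coordinate change ("tangent_coords").
   The chosen chart may jump from point to point, so smoothness of fields is always expressed
   through their components in the charts of the atlas. *)
definition chart_at :: "('a, 'm::finite) chart set \<Rightarrow> 'a \<Rightarrow> ('a, 'm) chart" where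
  "chart_at A p = (SOME c. c \<in> A \<and> p \<in> cdom c)"

definition tangent_coords ::
  "('a, 'm::finite) chart set \<Rightarrow> ('a, 'm) chart \<Rightarrow> 'a \<Rightarrow> real ^ 'm \<Rightarrow> real ^ 'm" where
  "tangent_coords A c p =
     frechet_derivative (chart_change (chart_at A p) c) (at (cmap (chart_at A p) p))"

(* The tangent vector at p whose components in the chart c are u, i.e. sum_i u_i d/dx_i. *)
definition coord_vec ::
  "('a, 'm::finite) chart set \<Rightarrow> ('a, 'm) chart \<Rightarrow> 'a \<Rightarrow> real ^ 'm \<Rightarrow> real ^ 'm" where
  "coord_vec A c p =
     frechet_derivative (chart_change c (chart_at A p)) (at (cmap c p))"

section \<open>Smooth functions, vector fields and tensor fields\<close>

type_synonym ('a, 'm) vfield = "'a \<Rightarrow> real ^ 'm"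
type_synonym ('a, 'm) oneform = "'a \<Rightarrow> real ^ 'm \<Rightarrow> real"
type_synonym ('a, 'm) endofield = "'a \<Rightarrow> real ^ 'm \<Rightarrow> real ^ 'm"
type_synonym ('a, 'm) bilfield = "'a \<Rightarrow> real ^ 'm \<Rightarrow> real ^ 'm \<Rightarrow> real"

definition smooth_fun :: "('a, 'm::finite) chart set \<Rightarrow> ('a \<Rightarrow> real) \<Rightarrow> bool" where
  "smooth_fun A f \<longleftrightarrow> (\<forall>c\<in>A. smooth_on (f \<circ> cinv c) (cran c))"

definition vf_in_chart ::
  "('a, 'm::finite) chart set \<Rightarrow> ('a, 'm) chart \<Rightarrow> ('a, 'm) vfield \<Rightarrow> real ^ 'm \<Rightarrow> real ^ 'm" where
  "vf_in_chart A c X = (\<lambda>u. tangent_coords A c (cinv c u) (X (cinv c u)))"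

definition smooth_vf :: "('a, 'm::finite) chart set \<Rightarrow> ('a, 'm) vfield \<Rightarrow> bool" where
  "smooth_vf A X \<longleftrightarrow> (\<forall>c\<in>A. smooth_on (vf_in_chart A c X) (cran c))"

definition smooth_oneform :: "('a, 'm::finite) chart set \<Rightarrow> ('a, 'm) oneform \<Rightarrow> bool" where
  "smooth_oneform A \<alpha> \<longleftrightarrow>
     (\<forall>p. linear (\<alpha> p)) \<and>
     (\<forall>c\<in>A. \<forall>v. smooth_on (\<lambda>u. \<alpha> (cinv c u) (coord_vec A c (cinv c u) v)) (cran c))"

definition smooth_endofield :: "('a, 'm::finite) chart set \<Rightarrow> ('a, 'm) endofield \<Rightarrow> bool" where
  "smooth_endofield A \<phi> \<longleftrightarrow>
     (\<forall>p. linear (\<phi> p)) \<and>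
     (\<forall>c\<in>A. \<forall>v. smooth_on
        (vf_in_chart A c (\<lambda>p. \<phi> p (coord_vec A c p v))) (cran c))"

definition smooth_bilfield :: "('a, 'm::finite) chart set \<Rightarrow> ('a, 'm) bilfield \<Rightarrow> bool" where
  "smooth_bilfield A b \<longleftrightarrow>
     (\<forall>p. bilinear (b p)) \<and>
     (\<forall>c\<in>A. \<forall>v w. smooth_on
        (\<lambda>u. b (cinv c u) (coord_vec A c (cinv c u) v) (coord_vec A c (cinv c u) w)) (cran c))"

(* The function X f. *)
definition vf_deriv ::
  "('a, 'm::finite) chart set \<Rightarrow> ('a, 'm) vfield \<Rightarrow> ('a \<Rightarrow> real) \<Rightarrow> 'a \<Rightarrow> real" where
  "vf_deriv A X f p =
     frechet_derivative (f \<circ> cinv (chart_at A p)) (at (cmap (chart_at A p) p)) (X p)"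

(* [X,Y]^i = X^j d_j Y^i - Y^j d_j X^i in the chart chosen at p. *)
definition lie_bracket ::
  "('a, 'm::finite) chart set \<Rightarrow> ('a, 'm) vfield \<Rightarrow> ('a, 'm) vfield \<Rightarrow> ('a, 'm) vfield" where
  "lie_bracket A X Y p =
     (let c = chart_at A p; u = cmap c p in
        frechet_derivative (vf_in_chart A c Y) (at u) (X p)
      - frechet_derivative (vf_in_chart A c X) (at u) (Y p))"

definition lie_deriv_bil ::
  "('a, 'm::finite) chart set \<Rightarrow> ('a, 'm) vfield \<Rightarrow> ('a, 'm) bilfield \<Rightarrow>
   ('a, 'm) vfield \<Rightarrow> ('a, 'm) vfield \<Rightarrow> 'a \<Rightarrow> real" where
  "lie_deriv_bil A X b Y Z p =
     vf_deriv A X (\<lambda>q. b q (Y q) (Z q)) p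
     - b p (lie_bracket A X Y p) (Z p) - b p (Y p) (lie_bracket A X Z p)"

section \<open>Pseudo-Riemannian metrics and the Levi-Civita connection\<close>

(* There is an orthonormal basis, indexed by 'm, with r vectors of square 1 and s of square -1;
   in particular r + s = CARD('m) and the form is nondegenerate. *)
definition has_signature ::
  "(real ^ 'm::finite \<Rightarrow> real ^ 'm \<Rightarrow> real) \<Rightarrow> nat \<Rightarrow> nat \<Rightarrow> bool" where
  "has_signature b r s \<longleftrightarrow>
     (\<exists>(e :: 'm \<Rightarrow> real ^ 'm) I. card I = r \<and> card (- I) = s \<and>
        (\<forall>i j. b (e i) (e j) = (if i = j then (if i \<in> I then 1 else - 1) else 0)))"

definition pseudo_riemannian_metric ::
  "('a, 'm::finite) chart set \<Rightarrow> nat \<Rightarrow> nat \<Rightarrow> ('a, 'm) bilfield \<Rightarrow> bool" where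
  "pseudo_riemannian_metric A r s g \<longleftrightarrow>
     smooth_bilfield A g \<and> (\<forall>p v w. g p v w = g p w v) \<and> (\<forall>p. has_signature (g p) r s)"

type_synonym ('a, 'm) connection = "('a, 'm) vfield \<Rightarrow> ('a, 'm) vfield \<Rightarrow> ('a, 'm) vfield"

(* Only the values on smooth vector fields are relevant. *)
definition affine_connection ::
  "('a, 'm::finite) chart set \<Rightarrow> ('a, 'm) connection \<Rightarrow> bool" where
  "affine_connection A D \<longleftrightarrow>
     (\<forall>X Y. smooth_vf A X \<longrightarrow> smooth_vf A Y \<longrightarrow> smooth_vf A (D X Y)) \<and>
     (\<forall>X X' Y. smooth_vf A X \<longrightarrow> smooth_vf A X' \<longrightarrow> smooth_vf A Y \<longrightarrow>
        D (\<lambda>p. X p + X' p) Y = (\<lambda>p. D X Y p + D X' Y p)) \<and>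
     (\<forall>f X Y. smooth_fun A f \<longrightarrow> smooth_vf A X \<longrightarrow> smooth_vf A Y \<longrightarrow>
        D (\<lambda>p. f p *\<^sub>R X p) Y = (\<lambda>p. f p *\<^sub>R D X Y p)) \<and>
     (\<forall>X Y Y'. smooth_vf A X \<longrightarrow> smooth_vf A Y \<longrightarrow> smooth_vf A Y' \<longrightarrow>
        D X (\<lambda>p. Y p + Y' p) = (\<lambda>p. D X Y p + D X Y' p)) \<and>
     (\<forall>f X Y. smooth_fun A f \<longrightarrow> smooth_vf A X \<longrightarrow> smooth_vf A Y \<longrightarrow>
        D X (\<lambda>p. f p *\<^sub>R Y p) = (\<lambda>p. vf_deriv A X f p *\<^sub>R Y p + f p *\<^sub>R D X Y p))"

definition levi_civita ::
  "('a, 'm::finite) chart set \<Rightarrow> ('a, 'm) bilfield \<Rightarrow> ('a, 'm) connection \<Rightarrow> bool" where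
  "levi_civita A g D \<longleftrightarrow>
     affine_connection A D \<and>
     (\<forall>X Y p. smooth_vf A X \<longrightarrow> smooth_vf A Y \<longrightarrow>
        D X Y p - D Y X p = lie_bracket A X Y p) \<and>
     (\<forall>X Y Z p. smooth_vf A X \<longrightarrow> smooth_vf A Y \<longrightarrow> smooth_vf A Z \<longrightarrow>
        vf_deriv A X (\<lambda>q. g q (Y q) (Z q)) p = g p (D X Y p) (Z p) + g p (Y p) (D X Z p))"

section \<open>Curvature\<close>

definition riemann_curv ::
  "('a, 'm::finite) chart set \<Rightarrow> ('a, 'm) connection \<Rightarrow>
   ('a, 'm) vfield \<Rightarrow> ('a, 'm) vfield \<Rightarrow> ('a, 'm) vfield \<Rightarrow> ('a, 'm) vfield" where
  "riemann_curv A D X Y Z =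
     (\<lambda>p. D X (D Y Z) p - D Y (D X Z) p - D (lie_bracket A X Y) Z p)"

(* R is tensorial in its first argument, so for smooth Y, Z the endomorphism L of the tangent
   space at p with L (X p) = (R(X,Y)Z) p for all X exists and is unique. *)
definition ricci ::
  "('a, 'm::finite) chart set \<Rightarrow> ('a, 'm) connection \<Rightarrow>
   ('a, 'm) vfield \<Rightarrow> ('a, 'm) vfield \<Rightarrow> 'a \<Rightarrow> real" where
  "ricci A D Y Z p =
     trace (matrix (THE L :: real ^ 'm \<Rightarrow> real ^ 'm.
       linear L \<and> (\<forall>X. smooth_vf A X \<longrightarrow> L (X p) = riemann_curv A D X Y Z p)))"

definition ricci_op ::
  "('a, 'm::finite) chart set \<Rightarrow> ('a, 'm) bilfield \<Rightarrow> ('a, 'm) connection \<Rightarrow>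
   ('a, 'm) vfield \<Rightarrow> ('a, 'm) vfield" where
  "ricci_op A g D X p =
     (THE w. \<forall>Y. smooth_vf A Y \<longrightarrow> g p w (Y p) = ricci A D X Y p)"

definition W2_curv ::
  "('a, 'm::finite) chart set \<Rightarrow> nat \<Rightarrow> ('a, 'm) bilfield \<Rightarrow> ('a, 'm) connection \<Rightarrow>
   ('a, 'm) vfield \<Rightarrow> ('a, 'm) vfield \<Rightarrow> ('a, 'm) vfield \<Rightarrow> ('a, 'm) vfield" where
  "W2_curv A n g D X Y Z =
     (\<lambda>p. riemann_curv A D X Y Z p +
       (1 / (2 * real n)) *\<^sub>R (g p (X p) (Z p) *\<^sub>R ricci_op A g D Y p
                            - g p (Y p) (Z p) *\<^sub>R ricci_op A g D X p))"

section \<open>Para-Kenmotsu structures and \<eta>-Ricci solitons\<close>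

definition paracomplex_on ::
  "(real ^ 'm::finite) set \<Rightarrow> nat \<Rightarrow> (real ^ 'm \<Rightarrow> real ^ 'm) \<Rightarrow> bool" where
  "paracomplex_on V n P \<longleftrightarrow>
     P ` V \<subseteq> V \<and> (\<forall>v\<in>V. P (P v) = v) \<and>
     dim {v \<in> V. P v = v} = n \<and> dim {v \<in> V. P v = - v} = n"

definition almost_paracontact_metric ::
  "('a, 'm::finite) chart set \<Rightarrow> nat \<Rightarrow> ('a, 'm) endofield \<Rightarrow> ('a, 'm) vfield \<Rightarrow>
   ('a, 'm) oneform \<Rightarrow> ('a, 'm) bilfield \<Rightarrow> bool" where
  "almost_paracontact_metric A n \<phi> \<xi> \<eta> g \<longleftrightarrow>
     smooth_endofield A \<phi> \<and> smooth_vf A \<xi> \<and> smooth_oneform A \<eta> \<and>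
     pseudo_riemannian_metric A (n + 1) n g \<and>
     (\<forall>p. \<phi> p (\<xi> p) = 0) \<and> (\<forall>p v. \<eta> p (\<phi> p v) = 0) \<and>
     (\<forall>p. \<eta> p (\<xi> p) = 1) \<and> (\<forall>p v. \<phi> p (\<phi> p v) = v - \<eta> p v *\<^sub>R \<xi> p) \<and>
     (\<forall>p. paracomplex_on {v. \<eta> p v = 0} n (\<phi> p)) \<and>
     (\<forall>X Y p. smooth_vf A X \<longrightarrow> smooth_vf A Y \<longrightarrow>
        g p (\<phi> p (X p)) (\<phi> p (Y p)) = - g p (X p) (Y p) + \<eta> p (X p) * \<eta> p (Y p))"

definition cov_deriv_endo ::
  "('a, 'm::finite) connection \<Rightarrow> ('a, 'm) vfield \<Rightarrow> ('a, 'm) endofield \<Rightarrow>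
   ('a, 'm) vfield \<Rightarrow> ('a, 'm) vfield" where
  "cov_deriv_endo D X \<phi> Y = (\<lambda>p. D X (\<lambda>q. \<phi> q (Y q)) p - \<phi> p (D X Y p))"

definition para_kenmotsu ::
  "('a, 'm::finite) chart set \<Rightarrow> nat \<Rightarrow> ('a, 'm) connection \<Rightarrow> ('a, 'm) endofield \<Rightarrow>
   ('a, 'm) vfield \<Rightarrow> ('a, 'm) oneform \<Rightarrow> ('a, 'm) bilfield \<Rightarrow> bool" where
  "para_kenmotsu A n D \<phi> \<xi> \<eta> g \<longleftrightarrow>
     almost_paracontact_metric A n \<phi> \<xi> \<eta> g \<and> levi_civita A g D \<and>
     (\<forall>X Y p. smooth_vf A X \<longrightarrow> smooth_vf A Y \<longrightarrow>
        cov_deriv_endo D X \<phi> Y p =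
          g p (\<phi> p (X p)) (Y p) *\<^sub>R \<xi> p - \<eta> p (Y p) *\<^sub>R \<phi> p (X p))"

definition eta_ricci_soliton ::
  "('a, 'm::finite) chart set \<Rightarrow> ('a, 'm) connection \<Rightarrow> ('a, 'm) vfield \<Rightarrow>
   ('a, 'm) oneform \<Rightarrow> ('a, 'm) bilfield \<Rightarrow> real \<Rightarrow> real \<Rightarrow> bool" where
  "eta_ricci_soliton A D \<xi> \<eta> g lam mu \<longleftrightarrow>
     (\<forall>X Y p. smooth_vf A X \<longrightarrow> smooth_vf A Y \<longrightarrow>
        lie_deriv_bil A \<xi> g X Y p + 2 * ricci A D X Y p
        + 2 * lam * g p (X p) (Y p) + 2 * mu * \<eta> p (X p) * \<eta> p (Y p) = 0)"

end

theory Submission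
  imports Defs
begin

text \<open>
  Since \<open>\<nabla>\<^sub>X \<xi> = X - \<eta>(X) \<xi>\<close>, the soliton equation gives
  \<open>S = -(\<lambda>+1) g - (\<mu>-1) \<eta> \<otimes> \<eta>\<close>, and \<open>R(X,Y)\<xi> = \<eta>(X) Y - \<eta>(Y) X\<close> gives
  \<open>S(\<xi>,\<xi>) = -2n\<close>, so that \<open>\<lambda> + \<mu> = 2n\<close>.  For \<open>X\<close>, \<open>Z\<close> in \<open>ker \<eta>\<close> one finds
  \<open>W\<^sub>2(\<xi>,X)\<xi> = (1 - (\<lambda>+1)/2n) X\<close> and \<open>\<eta>(W\<^sub>2(\<xi>,X)Z) = 0\<close>.  Hence the hypothesis with \<open>Y = \<xi>\<close>
  reads \<open>(\<lambda>+1) (1 - (\<lambda>+1)/2n) g(X,Z) = 0\<close>, and \<open>g\<close> does not vanish on \<open>ker \<eta>\<close>.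

  The trace defining \<open>S\<close> ranges over global fields.  It is well defined because bump functions
  extend every tangent vector to a global smooth field.
\<close>

section \<open>Calculus of smooth maps\<close>

text \<open>Derivatives at a point of an open set depend only on nearby values, so agreement on S
  passes to all directional derivatives. Hence \<open>f\<close> and \<open>h\<close> vary in the
  induction.\<close>

lemma Ck_on_cong:
  assumes "open S" "\<And>x. x \<in> S \<Longrightarrow> f x = h x"
  shows "Ck_on k f S \<longleftrightarrow> Ck_on k h S"
  using assms(2)
proof (induction k arbitrary: f h)
  case 0
  then show ?case by (simp cong: continuous_on_cong)
next
  case (Suc k)
  have D: "(f has_derivative F) (at x) \<longleftrightarrow> (h has_derivative F) (at x)" if "x \<in> S" for x F
    using has_derivative_transform_within_open[OF _ assms(1) that] Suc.prems by metis
  have "frechet_derivative f (at x) = frechet_derivative h (at x)" if "x \<in> S" for x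
    unfolding frechet_derivative_def using D[OF that] by simp
  then have "Ck_on k (\<lambda>x. frechet_derivative f (at x) v) S
      \<longleftrightarrow> Ck_on k (\<lambda>x. frechet_derivative h (at x) v) S" for v
    by (intro Suc.IH) simp
  then show ?case
    using D by (auto simp: differentiable_def)
qed

lemma Ck_on_transform:
  "open S \<Longrightarrow> Ck_on k h S \<Longrightarrow> (\<And>x. x \<in> S \<Longrightarrow> f x = h x) \<Longrightarrow> Ck_on k f S"
  using Ck_on_cong[of S f h k] by simp

lemma Ck_on_SucD: "Ck_on (Suc k) f S \<Longrightarrow> Ck_on k f S"
proof (induction k arbitrary: f)
  case 0
  then show ?case
    by (auto intro!: continuous_at_imp_continuous_on differentiable_imp_continuous_within)
next
  case (Suc k)
  have "Ck_on k (\<lambda>x. frechet_derivative f (at x) v) S" for v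
    using Suc.prems by (intro Suc.IH) (simp only: Ck_on.simps(2)[of "Suc k" f])
  then show ?case
    using Suc.prems by (simp only: Ck_on.simps) blast
qed

text \<open>Continuity and differentiability are local, hence so is each order. In
  \<open>smooth_vf_extension\<close> this permits different open sets to be treated by different
  formulas.\<close>

lemma Ck_on_local:
  assumes "\<And>x. x \<in> S \<Longrightarrow> \<exists>T. open T \<and> x \<in> T \<and> Ck_on k f T"
  shows "Ck_on k f S"
  using assms
proof (induction k arbitrary: f)
  case 0
  then show ?case
    by (auto intro!: continuous_at_imp_continuous_on) (metis continuous_on_eq_continuous_at)
next
  case (Suc k)
  show ?case
    unfolding Ck_on.simps
  proof (intro conjI allI ballI)
    show "f differentiable at x" if "x \<in> S" for x
      using Suc.prems[OF that] by auto
    show "Ck_on k (\<lambda>x. frechet_derivative f (at x) v) S" for v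
      using Suc.prems by (intro Suc.IH) (force simp del: frechet_derivative_const)
  qed
qed

lemma Ck_on_const: "Ck_on k (\<lambda>x. c) S"
  by (induction k arbitrary: c) (auto simp: frechet_derivative_const)

text \<open>An explicit formula for the derivative replaces \<open>frechet_derivative\<close>; the
  sum, product and chain rules below all raise the order through this rule.\<close>

lemma Ck_on_SucI:
  assumes "open S" and D: "\<And>x. x \<in> S \<Longrightarrow> (f has_derivative f' x) (at x)"
    and C: "\<And>v. Ck_on k (\<lambda>x. f' x v) S"
  shows "Ck_on (Suc k) f S"
proof -
  have "frechet_derivative f (at x) = f' x" if "x \<in> S" for x
    using frechet_derivative_at[OF D[OF that]] by simp
  then have "Ck_on k (\<lambda>x. frechet_derivative f (at x) v) S" for v
    by (intro iffD2[OF Ck_on_cong[OF assms(1)] C[of v]]) simp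
  then show ?thesis using D unfolding Ck_on.simps differentiable_def by blast
qed

lemma Ck_on_SucE:
  assumes "Ck_on (Suc k) f S" "x \<in> S"
  shows "(f has_derivative frechet_derivative f (at x)) (at x)"
  using assms by (simp add: frechet_derivative_works[symmetric])

lemma Ck_on_add:
  assumes "open S" "Ck_on k f S" "Ck_on k h S"
  shows "Ck_on k (\<lambda>x. f x + h x) S"
  using assms(2,3)
proof (induction k arbitrary: f h)
  case 0
  then show ?case by (auto intro: continuous_on_add)
next
  case (Suc k)
  show ?case
    by (rule Ck_on_SucI[OF assms(1)
          has_derivative_add[OF Ck_on_SucE[OF Suc.prems(1)] Ck_on_SucE[OF Suc.prems(2)]]])
      (use Suc in simp_all)
qed

lemma Ck_on_sum:
  assumes "open S" "\<And>i. i \<in> I \<Longrightarrow> Ck_on k (f i) S"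
  shows "Ck_on k (\<lambda>x. \<Sum>i\<in>I. f i x) S"
  using assms(2)
  by (induction I rule: infinite_finite_induct) (auto intro: Ck_on_const Ck_on_add assms(1))

text \<open>By the Leibniz rule the derivative is again a sum of values of \<open>B\<close>, with
  one factor differentiated; the induction hypothesis covers both terms.\<close>

lemma Ck_on_bilinear:
  assumes "bounded_bilinear B" "open S" "Ck_on k f S" "Ck_on k h S"
  shows "Ck_on k (\<lambda>x. B (f x) (h x)) S"
  using assms(3,4)
proof (induction k arbitrary: f h)
  case 0
  then show ?case by (auto intro: bounded_bilinear.continuous_on[OF assms(1)])
next
  case (Suc k)
  have C: "Ck_on k (\<lambda>x. B (f x) (frechet_derivative h (at x) v) + B (frechet_derivative f (at x) v) (h x)) S" for v
    using Suc.prems by (intro Ck_on_add[OF assms(2)] Suc.IH Ck_on_SucD[of k f] Ck_on_SucD[of k h]) auto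
  show ?case
    by (rule Ck_on_SucI[OF assms(2) bounded_bilinear.FDERIV[OF assms(1)
            Ck_on_SucE[OF Suc.prems(1)] Ck_on_SucE[OF Suc.prems(2)]] C])
qed

lemmas Ck_on_scaleR = Ck_on_bilinear[OF bounded_bilinear_scaleR]
lemmas Ck_on_inner = Ck_on_bilinear[OF bounded_bilinear_inner]

lemma Ck_on_bounded_linear:
  assumes "bounded_linear f" shows "Ck_on k f S"
proof (cases k)
  case 0
  then show ?thesis using assms by (simp add: linear_continuous_on)
next
  case (Suc j)
  have "(f has_derivative f) (at x)" for x
    using assms by (rule bounded_linear_imp_has_derivative)
  then have "f differentiable (at x)" "frechet_derivative f (at x) = f" for x
    using frechet_derivative_at by (metis differentiable_def, metis)
  then show ?thesis using Suc by (simp add: Ck_on_const)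
qed

lemma Ck_on_compose:
  fixes f :: "'b::euclidean_space \<Rightarrow> 'c::real_normed_vector"
  assumes "open S" "open T" "\<And>x. x \<in> S \<Longrightarrow> h x \<in> T" "Ck_on k f T" "Ck_on k h S"
  shows "Ck_on k (\<lambda>x. f (h x)) S"
  using assms(4,5)
proof (induction k arbitrary: f)
  case 0
  then show ?case
    using assms(3) by (auto intro: continuous_on_compose2)
next
  case (Suc k)
  \<comment> \<open>In the chain rule both the base point and the direction fed to the derivative of
    \<open>f\<close> vary with x. Expanding the direction in the basis leaves derivatives of
    \<open>f\<close> in fixed directions, to which the induction hypothesis applies.\<close>
  let ?f' = "\<lambda>x v. \<Sum>b\<in>Basis. (frechet_derivative h (at x) v \<bullet> b) *\<^sub>R frechet_derivative f (at (h x)) b"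
  have D: "((\<lambda>x. f (h x)) has_derivative ?f' x) (at x)" if x: "x \<in> S" for x
  proof -
    have df: "(f has_derivative frechet_derivative f (at (h x))) (at (h x))"
      using Ck_on_SucE[OF Suc.prems(1) assms(3)[OF x]] .
    have lin: "linear (frechet_derivative f (at (h x)))"
      using has_derivative_linear[OF df] .
    have "frechet_derivative f (at (h x)) w = (\<Sum>b\<in>Basis. (w \<bullet> b) *\<^sub>R frechet_derivative f (at (h x)) b)" for w
    proof -
      have "frechet_derivative f (at (h x)) w = frechet_derivative f (at (h x)) (\<Sum>b\<in>Basis. (w \<bullet> b) *\<^sub>R b)"
        by (simp only: euclidean_representation)
      also have "\<dots> = (\<Sum>b\<in>Basis. (w \<bullet> b) *\<^sub>R frechet_derivative f (at (h x)) b)"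
        by (simp only: linear_sum[OF lin] linear_cmul[OF lin])
      finally show ?thesis .
    qed
    then have "(\<lambda>v. frechet_derivative f (at (h x)) (frechet_derivative h (at x) v)) = ?f' x"
      by blast
    then show ?thesis
      using has_derivative_compose[OF Ck_on_SucE[OF Suc.prems(2) x] df] by simp
  qed
  have C: "Ck_on k (\<lambda>x. ?f' x v) S" for v
    using Suc.prems Ck_on_SucD[OF Suc.prems(2)]
    by (intro Ck_on_sum assms(1) Ck_on_scaleR Ck_on_inner Ck_on_const Suc.IH) auto
  show ?case by (rule Ck_on_SucI[OF assms(1) D C])
qed

section \<open>Bump functions\<close>

text \<open>The powers of 1/t make this family around exp(-1/t) closed under differentiation up to
  linear combinations, so smoothness of all members follows by one induction.\<close>

definition flat_exp :: "nat \<Rightarrow> real \<Rightarrow> real" where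
  "flat_exp k t = (if t > 0 then exp (- inverse t) * inverse t ^ k else 0)"

lemma flat_exp_tendsto_0: "(flat_exp k \<longlongrightarrow> 0) (at_right 0)"
proof -
  have "(((\<lambda>x. x ^ k / exp x) \<circ> inverse) \<longlongrightarrow> (0::real)) (at_right 0)"
    unfolding comp_def
    by (rule filterlim_compose[OF tendsto_power_div_exp_0 filterlim_inverse_at_top_right])
  moreover have "\<forall>\<^sub>F t in at_right 0. ((\<lambda>x. x ^ k / exp x) \<circ> inverse) t = flat_exp k t"
    unfolding eventually_at_right_field
    by (rule exI[of _ 1]) (auto simp: flat_exp_def exp_minus field_simps)
  ultimately show ?thesis
    by (rule Lim_transform_eventually)
qed

lemma flat_exp_has_field_derivative:
  "(flat_exp k has_real_derivative flat_exp (k + 2) t - k * flat_exp (k + 1) t) (at t)"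
proof -
  consider "t > 0" | "t < 0" | "t = 0" by linarith
  then show ?thesis
  proof cases
    case 1
    have "((\<lambda>t. exp (- inverse t) * inverse t ^ k) has_real_derivative
        exp (- inverse t) * (inverse t * inverse t) * inverse t ^ k
        - k * (inverse t * inverse t) * inverse t ^ (k - Suc 0) * exp (- inverse t)) (at t)"
      using 1 by (auto intro!: derivative_eq_intros simp: power2_eq_square)
    also have "exp (- inverse t) * (inverse t * inverse t) * inverse t ^ k
        - k * (inverse t * inverse t) * inverse t ^ (k - Suc 0) * exp (- inverse t)
        = flat_exp (k + 2) t - k * flat_exp (k + 1) t"
      using 1 by (cases k) (simp_all add: flat_exp_def)
    finally have "((\<lambda>t. exp (- inverse t) * inverse t ^ k) has_real_derivative
        flat_exp (k + 2) t - k * flat_exp (k + 1) t) (at t)" .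
    then show ?thesis
      by (rule has_field_derivative_transform_within_open[of _ _ _ "{0<..}"])
         (use 1 in \<open>auto simp: flat_exp_def\<close>)
  next
    case 2
    have "((\<lambda>t. 0) has_real_derivative 0) (at t)" by simp
    then have "(flat_exp k has_real_derivative 0) (at t)"
      by (rule has_field_derivative_transform_within_open[of _ _ _ "{..<0}"])
         (use 2 in \<open>auto simp: flat_exp_def\<close>)
    then show ?thesis using 2 by (simp add: flat_exp_def)
  next
    case 3
    \<comment> \<open>Since \<open>flat_exp k 0 = 0\<close>, this is the difference quotient at 0;
      to the right of 0 it equals \<open>flat_exp (Suc k)\<close>, and to the left it
      vanishes.\<close>
    have R: "((\<lambda>x. flat_exp k x / x) \<longlongrightarrow> 0) (at_right 0)"
      using flat_exp_tendsto_0[of "Suc k"]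
      by (rule Lim_transform_eventually)
         (auto simp: eventually_at_right_field flat_exp_def divide_inverse intro!: exI[of _ 1])
    have L: "((\<lambda>x. flat_exp k x / x) \<longlongrightarrow> 0) (at_left 0)"
      by (rule tendsto_eventually)
         (auto simp: eventually_at_left_field flat_exp_def intro!: exI[of _ "-1"])
    have "((\<lambda>x. flat_exp k x / x) \<longlongrightarrow> 0) (at 0)"
      using R L by (simp add: filterlim_at_split)
    then show ?thesis using 3 by (simp add: has_field_derivative_iff flat_exp_def)
  qed
qed

lemma Ck_on_flat_exp: "Ck_on m (flat_exp k) UNIV"
proof (induction m arbitrary: k)
  case 0
  then show ?case
    using flat_exp_has_field_derivative DERIV_isCont
    by (force intro!: continuous_at_imp_continuous_on)
next
  case (Suc m)
  have D: "(flat_exp k has_derivative (\<lambda>v. v *\<^sub>R (flat_exp (k + 2) t + (- real k) *\<^sub>R flat_exp (k + 1) t))) (at t)" for t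
    using flat_exp_has_field_derivative[of k t]
    by (simp add: has_field_derivative_def mult.commute[of _ "_ - _"] mult_commute_abs)
  have C: "Ck_on m (\<lambda>t. v *\<^sub>R (flat_exp (k + 2) t + (- real k) *\<^sub>R flat_exp (k + 1) t)) UNIV" for v
    by (intro Ck_on_scaleR Ck_on_add Suc.IH Ck_on_const) auto
  show ?case by (rule Ck_on_SucI[OF open_UNIV D C])
qed

lemma smooth_bump_exists:
  fixes x :: "'v::euclidean_space"
  assumes "r > 0"
  shows "\<exists>b :: 'v \<Rightarrow> real. smooth_on b UNIV \<and> b x = 1 \<and> (\<forall>y. y \<notin> cball x r \<longrightarrow> b y = 0)"
proof -
  \<comment> \<open>The argument r^2 - |y - x|^2 is positive exactly inside the open ball; the first
    factor normalises the value at the centre to 1. Differences are written as sums so that the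
    closure rules for \<open>Ck_on\<close> apply.\<close>
  define b where "b = (\<lambda>y. inverse (flat_exp 0 (r\<^sup>2)) *\<^sub>R flat_exp 0 (r\<^sup>2 + (-1) *\<^sub>R ((y + (- x)) \<bullet> (y + (- x)))))"
  have *: "Ck_on k (\<lambda>y. y + (- x)) UNIV" for k
    by (intro Ck_on_add Ck_on_const Ck_on_bounded_linear bounded_linear_ident open_UNIV)
  have "Ck_on k (\<lambda>y. r\<^sup>2 + (-1) *\<^sub>R ((y + (- x)) \<bullet> (y + (- x)))) UNIV" for k
    by (rule Ck_on_add[OF open_UNIV Ck_on_const
          Ck_on_scaleR[OF open_UNIV Ck_on_const Ck_on_inner[OF open_UNIV * *]]])
  from Ck_on_compose[OF open_UNIV open_UNIV UNIV_I Ck_on_flat_exp this]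
  have "smooth_on b UNIV"
    unfolding smooth_on_def b_def by (intro allI Ck_on_scaleR Ck_on_const open_UNIV)
  moreover have "b x = 1" using assms by (simp add: b_def flat_exp_def)
  moreover have "b y = 0" if "y \<notin> cball x r" for y
  proof -
    have "r\<^sup>2 \<le> (norm (y - x))\<^sup>2"
      using that assms by (intro power_mono) (auto simp: dist_norm norm_minus_commute)
    then show ?thesis by (simp add: b_def flat_exp_def power2_norm_eq_inner)
  qed
  ultimately show ?thesis by blast
qed

section \<open>Smooth fields on a manifold\<close>

locale smooth_manifold =
  fixes A :: "('a::{t2_space,second_countable_topology}, 'm::finite) chart set"
  assumes atlas: "smooth_atlas A"
begin

section \<open>Charts and Jacobians of coordinate changes\<close>

lemma chart_at_in: "chart_at A p \<in> A" and chart_at_dom: "p \<in> cdom (chart_at A p)"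
proof -
  have "p \<in> (\<Union>c\<in>A. cdom c)" using atlas by (simp add: smooth_atlas_def)
  then have "\<exists>c. c \<in> A \<and> p \<in> cdom c" by blast
  then have "chart_at A p \<in> A \<and> p \<in> cdom (chart_at A p)"
    unfolding chart_at_def by (rule someI_ex)
  then show "chart_at A p \<in> A" "p \<in> cdom (chart_at A p)" by auto
qed

lemma chart_homeomorphism: "c \<in> A \<Longrightarrow> homeomorphism (cdom c) (cran c) (cmap c) (cinv c)"
  and open_cdom: "c \<in> A \<Longrightarrow> open (cdom c)"
  and open_cran: "c \<in> A \<Longrightarrow> open (cran c)"
  using atlas by (auto simp: smooth_atlas_def)

lemma cinv_cmap: "c \<in> A \<Longrightarrow> q \<in> cdom c \<Longrightarrow> cinv c (cmap c q) = q"
  and cmap_cinv: "c \<in> A \<Longrightarrow> u \<in> cran c \<Longrightarrow> cmap c (cinv c u) = u"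
  and cinv_in_cdom: "c \<in> A \<Longrightarrow> u \<in> cran c \<Longrightarrow> cinv c u \<in> cdom c"
  using chart_homeomorphism[of c] unfolding homeomorphism_def by blast+

lemma open_chart_image:
  assumes "c \<in> A" "open U"
  shows "open (cmap c ` (cdom c \<inter> U))"
proof -
  have "openin (top_of_set (cran c)) (cmap c ` (cdom c \<inter> U))"
    using homeomorphism_imp_open_map[OF chart_homeomorphism[OF assms(1)]] assms(2)
    by (simp add: openin_open_Int)
  then show ?thesis using open_cran[OF assms(1)] by (simp add: openin_open_eq)
qed

lemma chart_change_cmap:
  "c \<in> A \<Longrightarrow> q \<in> cdom c \<Longrightarrow> chart_change c d (cmap c q) = cmap d q"
  by (simp add: chart_change_def cinv_cmap)

lemma chart_change_Ck:
  "c \<in> A \<Longrightarrow> d \<in> A \<Longrightarrow> Ck_on k (chart_change c d) (cmap c ` (cdom c \<inter> cdom d))"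
  using atlas by (simp add: smooth_atlas_def smooth_on_def)

text \<open>Indexing by the point of the manifold instead of its coordinates gives the cocycle law
  \<open>jac_trans\<close> without base-point changes. \<open>tangent_coords\<close> and
  \<open>coord_vec\<close> are the cases where one chart is the chosen one.\<close>

definition jac :: "('a, 'm) chart \<Rightarrow> ('a, 'm) chart \<Rightarrow> 'a \<Rightarrow> real ^ 'm \<Rightarrow> real ^ 'm" where
  "jac c d q = frechet_derivative (chart_change c d) (at (cmap c q))"

lemma tangent_coords_jac: "tangent_coords A c q = jac (chart_at A q) c q"
  and coord_vec_jac: "coord_vec A c q = jac c (chart_at A q) q"
  by (simp_all add: tangent_coords_def coord_vec_def jac_def)

lemma jac_has_derivative:
  assumes "c \<in> A" "d \<in> A" "q \<in> cdom c" "q \<in> cdom d"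
  shows "(chart_change c d has_derivative jac c d q) (at (cmap c q))"
  unfolding jac_def using assms
  by (intro Ck_on_SucE[OF chart_change_Ck[OF assms(1,2)]]) auto

lemma linear_jac:
  "c \<in> A \<Longrightarrow> d \<in> A \<Longrightarrow> q \<in> cdom c \<Longrightarrow> q \<in> cdom d \<Longrightarrow> linear (jac c d q)"
  using jac_has_derivative has_derivative_linear by blast

text \<open>This is the chain rule. The change from c to e factors through d only over the domain of
  d, whose image in c is an open neighbourhood of the point.\<close>

lemma jac_trans:
  assumes "c \<in> A" "d \<in> A" "e \<in> A" "q \<in> cdom c" "q \<in> cdom d" "q \<in> cdom e"
  shows "jac d e q (jac c d q v) = jac c e q v"
proof -
  have "(chart_change d e has_derivative jac d e q) (at (chart_change c d (cmap c q)))"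
    using jac_has_derivative[of d e q] assms by (simp add: chart_change_cmap)
  note has_derivative_compose[OF jac_has_derivative[OF assms(1,2,4,5)] this]
  then have "(chart_change c e has_derivative (\<lambda>v. jac d e q (jac c d q v))) (at (cmap c q))"
    by (rule has_derivative_transform_within_open
        [OF _ open_chart_image[OF assms(1) open_cdom[OF assms(2)]]])
      (use assms in \<open>auto simp: chart_change_cmap\<close>)
  then have "(\<lambda>v. jac d e q (jac c d q v)) = jac c e q"
    using jac_has_derivative[of c e q] assms has_derivative_unique by blast
  then show ?thesis by metis
qed

lemma jac_refl:
  assumes "c \<in> A" "q \<in> cdom c"
  shows "jac c c q v = v"
proof -
  have "(chart_change c c has_derivative (\<lambda>v. v)) (at (cmap c q))"
    by (rule has_derivative_transform_within_open[OF has_derivative_ident open_cran[OF assms(1)]])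
      (use assms in \<open>auto simp: chart_change_cmap\<close>)
  then have "(\<lambda>v. v) = jac c c q"
    using jac_has_derivative[of c c q] assms has_derivative_unique by blast
  then show ?thesis by metis
qed

lemma coord_vec_tangent_coords:
  "c \<in> A \<Longrightarrow> q \<in> cdom c \<Longrightarrow> coord_vec A c q (tangent_coords A c q v) = v"
  by (simp add: coord_vec_jac tangent_coords_jac jac_trans jac_refl chart_at_in chart_at_dom)

lemma tangent_coords_coord_vec:
  "c \<in> A \<Longrightarrow> d \<in> A \<Longrightarrow> q \<in> cdom c \<Longrightarrow> q \<in> cdom d \<Longrightarrow>
    tangent_coords A d q (coord_vec A c q v) = jac c d q v"
  by (simp add: coord_vec_jac tangent_coords_jac jac_trans chart_at_in chart_at_dom)

lemma linear_tangent_coords: "c \<in> A \<Longrightarrow> q \<in> cdom c \<Longrightarrow> linear (tangent_coords A c q)"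
  and linear_coord_vec: "c \<in> A \<Longrightarrow> q \<in> cdom c \<Longrightarrow> linear (coord_vec A c q)"
  by (simp_all add: coord_vec_jac tangent_coords_jac linear_jac chart_at_in chart_at_dom)

text \<open>Smoothness of forms is postulated only on coordinate fields; this expansion carries it
  over to arbitrary smooth fields.\<close>

lemma vf_coord_expansion:
  assumes "c \<in> A" "u \<in> cran c"
  shows "X (cinv c u) = (\<Sum>b\<in>Basis. (vf_in_chart A c X u \<bullet> b) *\<^sub>R coord_vec A c (cinv c u) b)"
proof -
  let ?q = "cinv c u"
  have q: "?q \<in> cdom c" using assms by (rule cinv_in_cdom)
  note lin = linear_coord_vec[OF assms(1) q]
  have "X ?q = coord_vec A c ?q (vf_in_chart A c X u)"
    by (simp add: vf_in_chart_def coord_vec_tangent_coords assms(1) q)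
  also have "\<dots> = coord_vec A c ?q (\<Sum>b\<in>Basis. (vf_in_chart A c X u \<bullet> b) *\<^sub>R b)"
    by (simp only: euclidean_representation)
  also have "\<dots> = (\<Sum>b\<in>Basis. (vf_in_chart A c X u \<bullet> b) *\<^sub>R coord_vec A c ?q b)"
    by (simp only: linear_sum[OF lin] linear_cmul[OF lin])
  finally show ?thesis .
qed

section \<open>Smoothness of contractions, sums and multiples; extension of tangent vectors\<close>

lemma smooth_fun_const: "smooth_fun A (\<lambda>_. r)"
  by (simp add: smooth_fun_def smooth_on_def comp_def Ck_on_const)

lemma vf_deriv_const: "vf_deriv A X (\<lambda>_. r) p = 0"
  by (simp add: vf_deriv_def comp_def)

lemma smooth_fun_oneform:
  assumes "smooth_oneform A \<alpha>" "smooth_vf A X"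
  shows "smooth_fun A (\<lambda>q. \<alpha> q (X q))"
  unfolding smooth_fun_def smooth_on_def
proof (intro ballI allI)
  fix c k assume c: "c \<in> A"
  have lin: "linear (\<alpha> q)" for q using assms(1) by (simp add: smooth_oneform_def)
  have "Ck_on k (\<lambda>u. \<alpha> (cinv c u) (coord_vec A c (cinv c u) v)) (cran c)" for v
    using assms(1) c by (simp add: smooth_oneform_def smooth_on_def)
  moreover have "Ck_on k (vf_in_chart A c X) (cran c)"
    using assms(2) c by (simp add: smooth_vf_def smooth_on_def)
  ultimately have "Ck_on k (\<lambda>u. \<Sum>b\<in>Basis. (vf_in_chart A c X u \<bullet> b) *\<^sub>R
      \<alpha> (cinv c u) (coord_vec A c (cinv c u) b)) (cran c)"
    by (intro Ck_on_sum Ck_on_scaleR Ck_on_inner Ck_on_const open_cran c)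
  moreover have "((\<lambda>q. \<alpha> q (X q)) \<circ> cinv c) u = (\<Sum>b\<in>Basis. (vf_in_chart A c X u \<bullet> b) *\<^sub>R
      \<alpha> (cinv c u) (coord_vec A c (cinv c u) b))" if "u \<in> cran c" for u
    by (simp only: o_def, subst vf_coord_expansion[OF c that])
      (simp only: linear_sum[OF lin] linear_cmul[OF lin])
  ultimately show "Ck_on k ((\<lambda>q. \<alpha> q (X q)) \<circ> cinv c) (cran c)"
    by (rule Ck_on_transform[OF open_cran[OF c]])
qed

lemma smooth_fun_bilfield:
  assumes "smooth_bilfield A b" "smooth_vf A X" "smooth_vf A Y"
  shows "smooth_fun A (\<lambda>q. b q (X q) (Y q))"
  unfolding smooth_fun_def smooth_on_def
proof (intro ballI allI)
  fix c k assume c: "c \<in> A"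
  have bil: "bilinear (b q)" for q using assms(1) by (simp add: smooth_bilfield_def)
  let ?F = "\<lambda>u. \<Sum>i\<in>Basis. (vf_in_chart A c X u \<bullet> i) *\<^sub>R (\<Sum>j\<in>Basis. (vf_in_chart A c Y u \<bullet> j) *\<^sub>R
      b (cinv c u) (coord_vec A c (cinv c u) i) (coord_vec A c (cinv c u) j))"
  have "Ck_on k (\<lambda>u. b (cinv c u) (coord_vec A c (cinv c u) v) (coord_vec A c (cinv c u) w)) (cran c)" for v w
    using assms(1) c by (simp add: smooth_bilfield_def smooth_on_def)
  moreover have "Ck_on k (vf_in_chart A c X) (cran c)" "Ck_on k (vf_in_chart A c Y) (cran c)"
    using assms(2,3) c by (simp_all add: smooth_vf_def smooth_on_def)
  ultimately have "Ck_on k ?F (cran c)"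
    by (intro Ck_on_sum Ck_on_scaleR Ck_on_inner Ck_on_const open_cran c)
  moreover have "((\<lambda>q. b q (X q) (Y q)) \<circ> cinv c) u = ?F u" if "u \<in> cran c" for u
  proof -
    have l1: "linear (\<lambda>x. b (cinv c u) x y)" and l2: "linear (b (cinv c u) x)" for x y
      using bil[of "cinv c u"] by (auto simp: bilinear_def eta_contract_eq)
    have "b (cinv c u) (X (cinv c u)) (Y (cinv c u)) =
       b (cinv c u) (\<Sum>i\<in>Basis. (vf_in_chart A c X u \<bullet> i) *\<^sub>R coord_vec A c (cinv c u) i)
         (\<Sum>j\<in>Basis. (vf_in_chart A c Y u \<bullet> j) *\<^sub>R coord_vec A c (cinv c u) j)"
      using vf_coord_expansion[OF c that, of X] vf_coord_expansion[OF c that, of Y] by simp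
    also have "\<dots> = ?F u"
      unfolding linear_sum[OF l1] linear_cmul[OF l1]
      unfolding linear_sum[OF l2] linear_cmul[OF l2] ..
    finally show ?thesis by simp
  qed
  ultimately show "Ck_on k ((\<lambda>q. b q (X q) (Y q)) \<circ> cinv c) (cran c)"
    by (rule Ck_on_transform[OF open_cran[OF c]])
qed

lemma smooth_vf_add:
  assumes "smooth_vf A X" "smooth_vf A Y"
  shows "smooth_vf A (\<lambda>q. X q + Y q)"
  unfolding smooth_vf_def smooth_on_def
proof (intro ballI allI)
  fix c k assume c: "c \<in> A"
  have "Ck_on k (\<lambda>u. vf_in_chart A c X u + vf_in_chart A c Y u) (cran c)"
    using assms c by (intro Ck_on_add open_cran) (simp_all add: smooth_vf_def smooth_on_def)
  moreover have "vf_in_chart A c (\<lambda>q. X q + Y q) u = vf_in_chart A c X u + vf_in_chart A c Y u"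
    if "u \<in> cran c" for u
    unfolding vf_in_chart_def
    by (rule linear_add[OF linear_tangent_coords[OF c cinv_in_cdom[OF c that]]])
  ultimately show "Ck_on k (vf_in_chart A c (\<lambda>q. X q + Y q)) (cran c)"
    by (rule Ck_on_transform[OF open_cran[OF c]])
qed

lemma smooth_vf_scaleR:
  assumes "smooth_fun A f" "smooth_vf A X"
  shows "smooth_vf A (\<lambda>q. f q *\<^sub>R X q)"
  unfolding smooth_vf_def smooth_on_def
proof (intro ballI allI)
  fix c k assume c: "c \<in> A"
  have "Ck_on k (\<lambda>u. (f \<circ> cinv c) u *\<^sub>R vf_in_chart A c X u) (cran c)"
    using assms c by (intro Ck_on_scaleR open_cran) (simp_all add: smooth_fun_def smooth_vf_def smooth_on_def o_def)
  moreover have "vf_in_chart A c (\<lambda>q. f q *\<^sub>R X q) u = (f \<circ> cinv c) u *\<^sub>R vf_in_chart A c X u"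
    if "u \<in> cran c" for u
    unfolding vf_in_chart_def o_def
    by (rule linear_cmul[OF linear_tangent_coords[OF c cinv_in_cdom[OF c that]]])
  ultimately show "Ck_on k (vf_in_chart A c (\<lambda>q. f q *\<^sub>R X q)) (cran c)"
    by (rule Ck_on_transform[OF open_cran[OF c]])
qed

lemma smooth_vf_cmul: "smooth_vf A X \<Longrightarrow> smooth_vf A (\<lambda>q. r *\<^sub>R X q)"
  by (rule smooth_vf_scaleR[OF smooth_fun_const])

lemma smooth_vf_diff:
  assumes "smooth_vf A X" "smooth_vf A Y"
  shows "smooth_vf A (\<lambda>q. X q - Y q)"
  using smooth_vf_add[OF assms(1) smooth_vf_cmul[OF assms(2), of "-1"]] by simp

text \<open>The field with constant components v in a chart at p is cut off by a bump function and
  extended by zero. Identities known only for global fields thereby become pointwise ones.\<close>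

lemma smooth_vf_extension: "\<exists>X. smooth_vf A X \<and> X p = v"
proof -
  define c where "c = chart_at A p"
  have c: "c \<in> A" "p \<in> cdom c" unfolding c_def by (rule chart_at_in chart_at_dom)+
  obtain r where r: "r > 0" "cball (cmap c p) r \<subseteq> cran c"
    using open_contains_cball_eq[OF open_cran[OF c(1)], THEN spec, THEN iffD1, OF imageI[OF c(2)]] by metis
  obtain b :: "real ^ 'm \<Rightarrow> real" where b: "smooth_on b UNIV" "b (cmap c p) = 1" "\<And>y. y \<notin> cball (cmap c p) r \<Longrightarrow> b y = 0"
    using smooth_bump_exists[OF r(1), of "cmap c p"] by metis
  \<comment> \<open>K carries the support of the cut-off field. As a compact subset of a Hausdorff
    space it is closed, so its complement and the domain of c form an open cover.\<close>
  define K where "K = cinv c ` cball (cmap c p) r"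
  have "continuous_on (cball (cmap c p) r) (cinv c)"
    using continuous_on_subset[OF homeomorphism_cont2[OF chart_homeomorphism[OF c(1)]] r(2)] .
  then have "closed K"
    unfolding K_def by (intro compact_imp_closed compact_continuous_image compact_cball)
  have "K \<subseteq> cdom c"
    using r(2) cinv_in_cdom[OF c(1)] by (auto simp: K_def)
  define X where "X = (\<lambda>q. if q \<in> cdom c then b (cmap c q) *\<^sub>R coord_vec A c q v else 0)"
  have X0: "X q = 0" if "q \<notin> K" for q
  proof (cases "q \<in> cdom c")
    case True
    then have "cmap c q \<notin> cball (cmap c p) r"
      using that cinv_cmap[OF c(1)] unfolding K_def by (metis imageI)
    then show ?thesis using b(3) by (simp add: X_def)
  qed (simp add: X_def)
  have "smooth_vf A X"
    unfolding smooth_vf_def smooth_on_def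
  proof (intro ballI allI Ck_on_local)
    fix d k u assume d: "d \<in> A" and u: "u \<in> cran d"
    define q where "q = cinv d u"
    have q: "q \<in> cdom d" "u = cmap d q"
      using u d by (simp_all add: q_def cinv_in_cdom cmap_cinv)
    show "\<exists>T. open T \<and> u \<in> T \<and> Ck_on k (vf_in_chart A d X) T"
    proof (cases "q \<in> cdom c")
      \<comment> \<open>On the overlap the components are the bump times a directional derivative of
        the coordinate change, both composed with the inverse change. One extra order of the
        coordinate change is spent on that derivative.\<close>
      case True
      let ?T = "cmap d ` (cdom d \<inter> cdom c)" and ?S = "cmap c ` (cdom c \<inter> cdom d)"
      have oT: "open ?T" and oS: "open ?S"
        by (intro open_chart_image open_cdom c(1) d)+
      have "Ck_on k (\<lambda>x. b (chart_change d c x)) ?T"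
        by (rule Ck_on_compose[OF oT open_UNIV])
          (use b(1) chart_change_Ck[OF d c(1)] in \<open>auto simp: smooth_on_def\<close>)
      moreover have "Ck_on k (\<lambda>x. frechet_derivative (chart_change c d) (at (chart_change d c x)) v) ?T"
        by (rule Ck_on_compose[OF oT oS, where f = "\<lambda>y. frechet_derivative (chart_change c d) (at y) v"])
          (use chart_change_Ck[OF d c(1)] chart_change_Ck[OF c(1) d, of "Suc k"] d
            in \<open>auto simp: chart_change_cmap\<close>)
      ultimately have "Ck_on k (\<lambda>x. b (chart_change d c x) *\<^sub>R
          frechet_derivative (chart_change c d) (at (chart_change d c x)) v) ?T"
        by (intro Ck_on_scaleR oT)
      moreover have "vf_in_chart A d X x = b (chart_change d c x) *\<^sub>R
          frechet_derivative (chart_change c d) (at (chart_change d c x)) v" if x: "x \<in> ?T" for x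
      proof -
        obtain s where s: "s \<in> cdom d" "s \<in> cdom c" "x = cmap d s" using x by blast
        then show ?thesis
          using tangent_coords_coord_vec[OF c(1) d s(2,1)] linear_cmul[OF linear_tangent_coords[OF d s(1)]]
          by (simp add: vf_in_chart_def X_def cinv_cmap d chart_change_cmap jac_def)
      qed
      ultimately have "Ck_on k (vf_in_chart A d X) ?T"
        by (rule Ck_on_transform[OF oT])
      then show ?thesis using oT q True by blast
    next
      \<comment> \<open>Off the domain of c the point lies outside K, and the field is zero on the
        whole open complement of K.\<close>
      case False
      let ?T = "cmap d ` (cdom d \<inter> - K)"
      have oT: "open ?T"
        using \<open>closed K\<close> by (intro open_chart_image d) (simp add: open_Compl)
      have "vf_in_chart A d X x = 0" if "x \<in> ?T" for x
        using that X0 linear_0[OF linear_tangent_coords[OF d]]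
        by (auto simp: vf_in_chart_def cinv_cmap d)
      then have "Ck_on k (vf_in_chart A d X) ?T"
        by (rule Ck_on_transform[OF oT Ck_on_const])
      then show ?thesis using oT q False \<open>K \<subseteq> cdom c\<close> by blast
    qed
  qed
  moreover have "X p = v"
    using c b(2) by (simp add: X_def coord_vec_jac c_def[symmetric] jac_refl)
  ultimately show ?thesis by blast
qed

end

section \<open>Para-Kenmotsu geometry\<close>

text \<open>Pairing with \<open>e j\<close> recovers the j-th coefficient of a combination up to
  sign. Hence the \<open>e j\<close> are independent, by dimension they span, and a vector
  orthogonal to all of them has no nonzero coefficient.\<close>

lemma has_signature_nondegenerate:
  fixes b :: "real ^ 'm::finite \<Rightarrow> real ^ 'm \<Rightarrow> real"
  assumes "has_signature b r s" "bilinear b" "\<And>w. b v w = 0"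
  shows "v = 0"
proof -
  obtain e :: "'m \<Rightarrow> real ^ 'm" and I where
    e: "\<And>i j. b (e i) (e j) = (if i = j then (if i \<in> I then 1 else - 1) else 0)"
    using assms(1) unfolding has_signature_def by blast
  define E where "E = (\<lambda>x :: real ^ 'm. \<Sum>i\<in>UNIV. (x $ i) *\<^sub>R e i)"
  have lin: "linear E"
    unfolding E_def by (intro linearI) (simp_all add: scaleR_add_left sum.distrib scaleR_sum_right)
  have l1: "linear (\<lambda>x. b x y)" for y
    using assms(2) by (simp add: bilinear_def)
  have comp: "x $ j = (if j \<in> I then 1 else - 1) * b (E x) (e j)" for x j
    unfolding E_def linear_sum[OF l1] linear_cmul[OF l1] e
    by (simp add: if_distrib[of "(*) _"] cong: if_cong)
  have E0: "x = 0" if "\<And>j. b (E x) (e j) = 0" for x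
    using comp[of x] that by (simp add: vec_eq_iff)
  have "inj E"
    unfolding linear_injective_0[OF lin]
    using E0 linear_0[OF l1] by simp
  then have "surj E" using linear_injective_imp_surjective[OF lin] by blast
  then obtain x where "v = E x" by (metis surjD)
  then show ?thesis using E0[of x] assms(3) linear_0[OF lin] by simp
qed

text \<open>The rank-one map has trace \<open>f w\<close>, the identity has trace the dimension.
  This is the shape of X \<mapsto> R(X,\<xi>)\<xi>.\<close>

lemma trace_rank_one_minus_id:
  fixes f :: "real ^ 'm::finite \<Rightarrow> real"
  assumes "linear f"
  shows "trace (matrix (\<lambda>v. f v *\<^sub>R w - v)) = f w - real CARD('m)"
proof -
  have "f w = f (\<Sum>i\<in>UNIV. (w $ i) *\<^sub>R axis i 1)"
    using basis_expansion[of w] by (simp add: scalar_mult_eq_scaleR)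
  also have "\<dots> = (\<Sum>i\<in>UNIV. w $ i * f (axis i 1))"
    by (simp add: linear_sum[OF assms] linear_cmul[OF assms])
  finally have "f w = (\<Sum>i\<in>UNIV. f (axis i 1) * w $ i)"
    by (simp add: mult.commute)
  then show ?thesis
    by (simp add: trace_def matrix_def sum_subtractf)
qed

locale para_kenmotsu_manifold = smooth_manifold A
  for A :: "('a::{t2_space,second_countable_topology}, 'm::finite) chart set" +
  fixes n :: nat
    and D :: "('a, 'm) connection"
    and \<phi> :: "('a, 'm) endofield"
    and \<xi> :: "('a, 'm) vfield"
    and \<eta> :: "('a, 'm) oneform"
    and g :: "('a, 'm) bilfield"
  assumes dimension: "CARD('m) = 2 * n + 1"
    and pk: "para_kenmotsu A n D \<phi> \<xi> \<eta> g"
begin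

section \<open>Algebra of the structure tensors\<close>

lemma apm: "almost_paracontact_metric A n \<phi> \<xi> \<eta> g"
  and lc: "levi_civita A g D"
  using pk by (simp_all add: para_kenmotsu_def)

lemma conn: "affine_connection A D"
  using lc by (simp add: levi_civita_def)

lemma smooth_xi: "smooth_vf A \<xi>"
  and phi_xi: "\<phi> p (\<xi> p) = 0"
  and eta_phi: "\<eta> p (\<phi> p v) = 0"
  and eta_xi: "\<eta> p (\<xi> p) = 1"
  and phi_phi: "\<phi> p (\<phi> p v) = v - \<eta> p v *\<^sub>R \<xi> p"
  using apm by (simp_all add: almost_paracontact_metric_def)

lemma smooth_eta: "smooth_oneform A \<eta>"
  using apm by (simp add: almost_paracontact_metric_def)

lemma linear_eta: "linear (\<eta> p)"
  using smooth_eta by (simp add: smooth_oneform_def)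

lemma metric: "pseudo_riemannian_metric A (n + 1) n g"
  using apm by (simp add: almost_paracontact_metric_def)

lemma smooth_g: "smooth_bilfield A g"
  and g_sym: "g p v w = g p w v"
  and signature_g: "has_signature (g p) (n + 1) n"
  using metric by (auto simp: pseudo_riemannian_metric_def)

lemma bilinear_g: "bilinear (g p)"
  using smooth_g by (simp add: smooth_bilfield_def)

lemmas g_linear = bilinear_ladd[OF bilinear_g] bilinear_radd[OF bilinear_g]
  bilinear_lsub[OF bilinear_g] bilinear_rsub[OF bilinear_g]
  bilinear_lmul[OF bilinear_g] bilinear_rmul[OF bilinear_g]
  bilinear_lneg[OF bilinear_g] bilinear_rneg[OF bilinear_g]
  bilinear_lzero[OF bilinear_g] bilinear_rzero[OF bilinear_g]

lemmas eta_linear = linear_add[OF linear_eta] linear_diff[OF linear_eta]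
  linear_cmul[OF linear_eta] linear_neg[OF linear_eta] linear_0[OF linear_eta]

text \<open>Put Y = \<xi> in the compatibility of g with \<phi>: the left side vanishes because
  \<phi>\<xi> = 0. Compatibility is stated for smooth fields, so the vector is first
  extended.\<close>

lemma eta_eq_g: "\<eta> p v = g p v (\<xi> p)"
proof -
  obtain X where X: "smooth_vf A X" "X p = v" using smooth_vf_extension by blast
  have "g p (\<phi> p (X p)) (\<phi> p (\<xi> p)) = - g p (X p) (\<xi> p) + \<eta> p (X p) * \<eta> p (\<xi> p)"
    using apm X(1) smooth_xi unfolding almost_paracontact_metric_def by blast
  then show ?thesis using X(2) by (simp add: phi_xi eta_xi g_linear)
qed

lemma g_xi: "g p (\<xi> p) v = \<eta> p v" "g p v (\<xi> p) = \<eta> p v"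
  using g_sym[of p v "\<xi> p"] by (simp_all add: eta_eq_g)

lemma smooth_fun_eta: "smooth_vf A X \<Longrightarrow> smooth_fun A (\<lambda>q. \<eta> q (X q))"
  by (rule smooth_fun_oneform[OF smooth_eta])

section \<open>The Levi-Civita connection and the structure tensors\<close>

lemma smooth_D: "smooth_vf A X \<Longrightarrow> smooth_vf A Y \<Longrightarrow> smooth_vf A (D X Y)"
  and D_add: "smooth_vf A X \<Longrightarrow> smooth_vf A Y \<Longrightarrow> smooth_vf A Y' \<Longrightarrow>
    D X (\<lambda>q. Y q + Y' q) = (\<lambda>q. D X Y q + D X Y' q)"
  and D_scale: "smooth_fun A f \<Longrightarrow> smooth_vf A X \<Longrightarrow> smooth_vf A Y \<Longrightarrow>
    D X (\<lambda>q. f q *\<^sub>R Y q) = (\<lambda>q. vf_deriv A X f q *\<^sub>R Y q + f q *\<^sub>R D X Y q)"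
  using conn unfolding affine_connection_def by blast+

lemma D_cmul: "smooth_vf A X \<Longrightarrow> smooth_vf A Y \<Longrightarrow> D X (\<lambda>q. r *\<^sub>R Y q) = (\<lambda>q. r *\<^sub>R D X Y q)"
  using D_scale[OF smooth_fun_const] by (simp add: vf_deriv_const)

lemma D_zero: "smooth_vf A X \<Longrightarrow> D X (\<lambda>_. 0) = (\<lambda>_. 0)"
  using D_cmul[OF _ smooth_xi, of X 0] by simp

lemma D_diff:
  assumes "smooth_vf A X" "smooth_vf A Y" "smooth_vf A Z"
  shows "D X (\<lambda>q. Y q - Z q) = (\<lambda>q. D X Y q - D X Z q)"
  using D_add[OF assms(1,2) smooth_vf_cmul[OF assms(3), of "-1"]] D_cmul[OF assms(1,3), of "-1"]
  by simp

lemma lie_bracket_D: "smooth_vf A X \<Longrightarrow> smooth_vf A Y \<Longrightarrow>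
    lie_bracket A X Y = (\<lambda>q. D X Y q - D Y X q)"
  and vf_deriv_g: "smooth_vf A X \<Longrightarrow> smooth_vf A Y \<Longrightarrow> smooth_vf A Z \<Longrightarrow>
    vf_deriv A X (\<lambda>q. g q (Y q) (Z q)) p = g p (D X Y p) (Z p) + g p (Y p) (D X Z p)"
  using lc unfolding levi_civita_def by (metis, blast)

lemma smooth_lie_bracket:
  "smooth_vf A X \<Longrightarrow> smooth_vf A Y \<Longrightarrow> smooth_vf A (lie_bracket A X Y)"
  by (simp add: lie_bracket_D smooth_vf_diff smooth_D)

text \<open>The structure equation at Y = \<xi> gives \<phi>(D X \<xi>) = \<phi>X, which fixes D X
  \<xi> up to a multiple of \<xi>. Constancy of g(\<xi>,\<xi>) = 1 makes its \<eta>-component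
  zero.\<close>

lemma D_xi:
  assumes X: "smooth_vf A X"
  shows "D X \<xi> = (\<lambda>q. X q - \<eta> q (X q) *\<^sub>R \<xi> q)"
proof
  fix p
  have "cov_deriv_endo D X \<phi> \<xi> p = g p (\<phi> p (X p)) (\<xi> p) *\<^sub>R \<xi> p - \<eta> p (\<xi> p) *\<^sub>R \<phi> p (X p)"
    using pk X smooth_xi unfolding para_kenmotsu_def by blast
  then have "\<phi> p (D X \<xi> p) = \<phi> p (X p)"
    by (simp add: cov_deriv_endo_def phi_xi D_zero[OF X] eta_phi eta_xi g_xi)
  then have "\<phi> p (\<phi> p (D X \<xi> p)) = \<phi> p (\<phi> p (X p))" by simp
  moreover have "\<eta> p (D X \<xi> p) = 0"
    using vf_deriv_g[OF X smooth_xi smooth_xi, of p] by (simp add: vf_deriv_const g_xi eta_xi)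
  ultimately show "D X \<xi> p = X p - \<eta> p (X p) *\<^sub>R \<xi> p"
    by (simp add: phi_phi)
qed

lemma vf_deriv_eta:
  assumes "smooth_vf A X" "smooth_vf A Y"
  shows "vf_deriv A X (\<lambda>q. \<eta> q (Y q)) p
    = \<eta> p (D X Y p) + g p (X p) (Y p) - \<eta> p (X p) * \<eta> p (Y p)"
  using vf_deriv_g[OF assms smooth_xi, of p] g_sym[of p "X p" "Y p"]
  by (simp add: g_xi D_xi[OF assms(1)] g_linear)

section \<open>Curvature in the direction of \<xi>\<close>

lemma riemann_curv_xi:
  assumes X: "smooth_vf A X" and Y: "smooth_vf A Y"
  shows "riemann_curv A D X Y \<xi> p = \<eta> p (X p) *\<^sub>R Y p - \<eta> p (Y p) *\<^sub>R X p"
proof -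
  \<comment> \<open>Of these terms, those in g(U,V) and in \<eta>(U)\<eta>(V) are symmetric and drop
    out on antisymmetrising. The terms in D U V are absorbed by the bracket, as the torsion
    vanishes.\<close>
  have DD: "D U (D V \<xi>) p = D U V p
      - (\<eta> p (D U V p) + g p (U p) (V p) - \<eta> p (U p) * \<eta> p (V p)) *\<^sub>R \<xi> p
      - \<eta> p (V p) *\<^sub>R (U p - \<eta> p (U p) *\<^sub>R \<xi> p)"
    if U: "smooth_vf A U" and V: "smooth_vf A V" for U V
    by (simp add: D_xi[OF V] D_diff[OF U V smooth_vf_scaleR[OF smooth_fun_eta[OF V] smooth_xi]]
        D_scale[OF smooth_fun_eta[OF V] U smooth_xi] D_xi[OF U] vf_deriv_eta[OF U V] algebra_simps)
  show ?thesis
    unfolding riemann_curv_def DD[OF X Y] DD[OF Y X] D_xi[OF smooth_lie_bracket[OF X Y]]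
    unfolding lie_bracket_D[OF X Y]
    using g_sym[of p "X p" "Y p"] by (simp add: eta_linear algebra_simps)
qed

lemma eta_D_horizontal:
  assumes "smooth_vf A X" "smooth_vf A Y" "\<And>q. \<eta> q (Y q) = 0"
  shows "\<eta> p (D X Y p) = - g p (X p) (Y p)"
  using vf_deriv_eta[OF assms(1,2), of p] by (simp add: assms(3) vf_deriv_const)

text \<open>The pair symmetry of \<open>R\<close> would give this from \<open>riemann_curv_xi\<close>; for horizontal fields a
  direct computation avoids the symmetry of second derivatives.\<close>

lemma eta_riemann_curv_horizontal:
  assumes X: "smooth_vf A X" "\<And>q. \<eta> q (X q) = 0" and Z: "smooth_vf A Z" "\<And>q. \<eta> q (Z q) = 0"
  shows "\<eta> p (riemann_curv A D \<xi> X Z p) = - g p (X p) (Z p)"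
proof -
  note s = smooth_xi X(1) Z(1)
  \<comment> \<open>D X Z is not horizontal in general, but along \<xi> the two correction terms of
    \<open>vf_deriv_eta\<close> cancel each other.\<close>
  have "\<eta> p (D \<xi> (D X Z) p) = vf_deriv A \<xi> (\<lambda>q. \<eta> q (D X Z q)) p"
    using vf_deriv_eta[OF smooth_xi smooth_D[OF X(1) Z(1)], of p]
    by (simp add: eta_xi g_xi)
  \<comment> \<open>This rewrites the function as -g(X,Z), which metric compatibility can
    differentiate.\<close>
  also have "(\<lambda>q. \<eta> q (D X Z q)) = (\<lambda>q. g q (-1 *\<^sub>R X q) (Z q))"
    using eta_D_horizontal[OF X(1) Z] by (simp add: g_linear)
  also have "vf_deriv A \<xi> \<dots> p = - g p (D \<xi> X p) (Z p) - g p (X p) (D \<xi> Z p)"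
    using vf_deriv_g[OF smooth_xi smooth_vf_cmul[OF X(1), of "-1"] Z(1), of p]
      D_cmul[OF smooth_xi X(1), of "-1"] by (simp add: g_linear)
  finally have 1: "\<eta> p (D \<xi> (D X Z) p) = - g p (D \<xi> X p) (Z p) - g p (X p) (D \<xi> Z p)" .
  \<comment> \<open>Differentiation along \<xi> preserves horizontality, so
    \<open>eta_D_horizontal\<close> applies a second time.\<close>
  have "\<eta> q (D \<xi> Z q) = 0" for q
    using eta_D_horizontal[OF smooth_xi Z, of q]
    by (simp add: g_xi Z(2))
  from eta_D_horizontal[OF X(1) smooth_D[OF smooth_xi Z(1)] this]
  have 2: "\<eta> p (D X (D \<xi> Z) p) = - g p (X p) (D \<xi> Z p)" .
  \<comment> \<open>For horizontal X one has D X \<xi> = X, so the bracket of \<xi> and X is D \<xi>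
    X - X; the last summand produces the curvature term.\<close>
  have 3: "\<eta> p (D (lie_bracket A \<xi> X) Z p) = - g p (D \<xi> X p) (Z p) + g p (X p) (Z p)"
    using eta_D_horizontal[OF smooth_lie_bracket[OF smooth_xi X(1)] Z, of p]
    by (simp add: lie_bracket_D[OF smooth_xi X(1)] D_xi[OF X(1)] X(2) g_linear)
  show ?thesis
    by (simp add: riemann_curv_def eta_linear 1 2 3)
qed

text \<open>The endomorphism is explicit by \<open>riemann_curv_xi\<close> and unique by extension
  of vectors; its trace is 1 - (2n + 1).\<close>

lemma ricci_xi_xi: "ricci A D \<xi> \<xi> p = - 2 * real n"
proof -
  let ?L = "\<lambda>v. \<eta> p v *\<^sub>R \<xi> p - v"
  have R: "riemann_curv A D X \<xi> \<xi> p = ?L (X p)" if "smooth_vf A X" for X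
    using riemann_curv_xi[OF that smooth_xi] by (simp add: eta_xi)
  have "linear ?L"
    by (intro linearI) (simp_all add: eta_linear algebra_simps)
  then have "(THE L. linear L \<and> (\<forall>X. smooth_vf A X \<longrightarrow> L (X p) = riemann_curv A D X \<xi> \<xi> p)) = ?L"
  proof (intro the_equality)
    fix L assume L: "linear L \<and> (\<forall>X. smooth_vf A X \<longrightarrow> L (X p) = riemann_curv A D X \<xi> \<xi> p)"
    show "L = ?L"
    proof
      fix v
      obtain X where "smooth_vf A X" "X p = v" using smooth_vf_extension by blast
      then show "L v = ?L v" using L R by metis
    qed
  qed (use R in simp)
  then show ?thesis
    by (simp add: ricci_def trace_rank_one_minus_id[OF linear_eta] eta_xi dimension)
qed

text \<open>Removing the \<xi>-component of any extension changes nothing at p. Horizontality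
  everywhere is what the differentiations in \<open>eta_riemann_curv_horizontal\<close> use.\<close>

lemma horizontal_extension:
  assumes "\<eta> p v = 0"
  shows "\<exists>X. smooth_vf A X \<and> (\<forall>q. \<eta> q (X q) = 0) \<and> X p = v"
proof -
  obtain X where X: "smooth_vf A X" "X p = v" using smooth_vf_extension by blast
  have "smooth_vf A (\<lambda>q. X q - \<eta> q (X q) *\<^sub>R \<xi> q)"
    by (intro smooth_vf_diff smooth_vf_scaleR smooth_fun_eta X(1) smooth_xi)
  then show ?thesis
    using X(2) assms by (intro exI[of _ "\<lambda>q. X q - \<eta> q (X q) *\<^sub>R \<xi> q"]) (simp add: eta_linear eta_xi)
qed

text \<open>The rank condition supplies a nonzero eigenvector v of \<phi> in ker \<eta>. Such a v is
  null, so a second vector comes from nondegeneracy; stripping off its \<xi>-component preserves its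
  product with v.\<close>

lemma horizontal_pair_exists:
  assumes "n \<ge> 1"
  shows "\<exists>v w. \<eta> p v = 0 \<and> \<eta> p w = 0 \<and> g p v w \<noteq> 0"
proof -
  let ?V = "{v \<in> {v. \<eta> p v = 0}. \<phi> p v = v}"
  have "dim ?V = n"
    using apm by (simp add: almost_paracontact_metric_def paracomplex_on_def)
  then have "\<not> ?V \<subseteq> {0}" using assms dim_eq_0[of ?V] by simp
  then obtain v where v: "\<eta> p v = 0" "v \<noteq> 0" by auto
  then obtain w where w: "g p v w \<noteq> 0"
    using has_signature_nondegenerate[OF signature_g bilinear_g] by metis
  have "g p v (w - \<eta> p w *\<^sub>R \<xi> p) = g p v w"
    using v(1) by (simp add: g_linear g_xi)
  moreover have "\<eta> p (w - \<eta> p w *\<^sub>R \<xi> p) = 0"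
    by (simp add: eta_linear eta_xi)
  ultimately show ?thesis using v w by metis
qed

section \<open>Consequences of the soliton equation and of the curvature condition\<close>

context
  fixes lam mu :: real
  assumes soliton: "eta_ricci_soliton A D \<xi> \<eta> g lam mu"
begin

lemma ricci_soliton:
  assumes X: "smooth_vf A X" and Y: "smooth_vf A Y"
  shows "ricci A D X Y p = - (lam + 1) * g p (X p) (Y p) - (mu - 1) * \<eta> p (X p) * \<eta> p (Y p)"
proof -
  \<comment> \<open>The D \<xi> terms cancel between the derivative of g and the brackets, leaving
    g(D X \<xi>, Y) + g(X, D Y \<xi>).\<close>
  have "lie_deriv_bil A \<xi> g X Y p = 2 * (g p (X p) (Y p) - \<eta> p (X p) * \<eta> p (Y p))"
    by (simp add: lie_deriv_bil_def vf_deriv_g[OF smooth_xi X Y] lie_bracket_D smooth_xi X Y D_xi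
        g_linear g_xi)
  moreover have "lie_deriv_bil A \<xi> g X Y p + 2 * ricci A D X Y p
        + 2 * lam * g p (X p) (Y p) + 2 * mu * \<eta> p (X p) * \<eta> p (Y p) = 0"
    using soliton X Y unfolding eta_ricci_soliton_def by blast
  ultimately show ?thesis by (simp add: algebra_simps)
qed

text \<open>S(\<xi>,\<xi>) is computed twice, from the soliton equation and as a trace. Any point
  will do, hence \<open>undefined\<close>.\<close>

lemma lam_plus_mu: "lam + mu = 2 * real n"
  using ricci_soliton[OF smooth_xi smooth_xi, of undefined] ricci_xi_xi[of undefined]
  by (simp add: g_xi eta_xi)

text \<open>The right side represents S(X,.) by \<open>ricci_soliton\<close>; nondegeneracy of g
  together with extension of vectors makes it the only such vector.\<close>

lemma ricci_op_soliton:
  assumes X: "smooth_vf A X"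
  shows "ricci_op A g D X = (\<lambda>q. - (lam + 1) *\<^sub>R X q - ((mu - 1) * \<eta> q (X q)) *\<^sub>R \<xi> q)"
proof
  fix p
  let ?w = "- (lam + 1) *\<^sub>R X p - ((mu - 1) * \<eta> p (X p)) *\<^sub>R \<xi> p"
  have Q: "g p ?w (Y p) = ricci A D X Y p" if "smooth_vf A Y" for Y
    using ricci_soliton[OF X that, of p]
    by (simp add: g_linear g_xi)
  show "ricci_op A g D X p = ?w"
    unfolding ricci_op_def
  proof (rule the_equality)
    fix w assume w: "\<forall>Y. smooth_vf A Y \<longrightarrow> g p w (Y p) = ricci A D X Y p"
    have "g p (w - ?w) u = 0" for u
    proof -
      obtain Y where Y: "smooth_vf A Y" "Y p = u" using smooth_vf_extension by blast
      then have "g p w u = g p ?w u" using w Q by metis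
      then show ?thesis by (simp only: bilinear_lsub[OF bilinear_g])
    qed
    from has_signature_nondegenerate[OF signature_g bilinear_g this] show "w = ?w" by simp
  qed (use Q in blast)
qed

text \<open>The formula for S holds for smooth fields only, and it is later applied with a value of
  \<open>W2_curv\<close> as an argument.\<close>

lemma smooth_W2:
  assumes X: "smooth_vf A X" and Y: "smooth_vf A Y" and Z: "smooth_vf A Z"
  shows "smooth_vf A (W2_curv A n g D X Y Z)"
proof -
  have Q: "smooth_vf A (ricci_op A g D V)" if V: "smooth_vf A V" for V
  proof -
    have "smooth_vf A (\<lambda>q. - (lam + 1) *\<^sub>R V q - (mu - 1) *\<^sub>R (\<eta> q (V q) *\<^sub>R \<xi> q))"
      by (intro smooth_vf_diff smooth_vf_cmul smooth_vf_scaleR smooth_fun_eta V smooth_xi)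
    then show ?thesis by (simp add: ricci_op_soliton[OF V])
  qed
  have R: "smooth_vf A (riemann_curv A D X Y Z)"
    unfolding riemann_curv_def
    by (intro smooth_vf_diff smooth_D smooth_lie_bracket X Y Z)
  show ?thesis
    unfolding W2_curv_def
    by (intro smooth_vf_add smooth_vf_diff smooth_vf_cmul smooth_vf_scaleR
        smooth_fun_bilfield[OF smooth_g] Q R X Y Z)
qed

lemma W2_semisymmetric_constants:
  assumes n: "n \<ge> 1"
    and W2S: "\<And>X Y Z p. smooth_vf A X \<Longrightarrow> smooth_vf A Y \<Longrightarrow> smooth_vf A Z \<Longrightarrow>
           ricci A D (W2_curv A n g D \<xi> X Y) Z p
         + ricci A D Y (W2_curv A n g D \<xi> X Z) p = 0"
  shows "(2 * real n - (lam + 1)) * (lam + 1) = 0"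
proof -
  fix p :: 'a
  obtain v w where vw: "\<eta> p v = 0" "\<eta> p w = 0" "g p v w \<noteq> 0"
    using horizontal_pair_exists[OF n] by blast
  obtain X where X: "smooth_vf A X" "\<And>q. \<eta> q (X q) = 0" "X p = v"
    using horizontal_extension[OF vw(1)] by blast
  obtain Z where Z: "smooth_vf A Z" "\<And>q. \<eta> q (Z q) = 0" "Z p = w"
    using horizontal_extension[OF vw(2)] by blast
  have Qxi: "ricci_op A g D \<xi> p = - (2 * real n) *\<^sub>R \<xi> p"
    unfolding lam_plus_mu[symmetric]
    by (simp add: ricci_op_soliton[OF smooth_xi] eta_xi algebra_simps)
  \<comment> \<open>k is the eigenvalue of the Ricci operator on ker \<eta>, while on \<xi> it is
    -2n.\<close>
  define k where "k = - (lam + 1)"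
  have QX: "ricci_op A g D X p = k *\<^sub>R X p"
    by (simp add: ricci_op_soliton[OF X(1)] X(2) k_def)
  \<comment> \<open>Here R(\<xi>,X)\<xi> = X and g(\<xi>,\<xi>) = 1; the term with Q\<xi> disappears
    because X is orthogonal to \<xi>.\<close>
  have "W2_curv A n g D \<xi> X \<xi> p = (1 + k / (2 * real n)) *\<^sub>R X p"
    by (simp add: W2_curv_def riemann_curv_xi[OF smooth_xi X(1)] eta_xi X(2) g_xi QX
        scaleR_add_left)
  then have 1: "ricci A D (W2_curv A n g D \<xi> X \<xi>) Z p
      = k * (1 + k / (2 * real n)) * g p v w"
    using X(3) Z(3) by (simp add: ricci_soliton[OF smooth_W2[OF smooth_xi X(1) smooth_xi] Z(1)]
        g_linear eta_linear vw(1) k_def)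
  \<comment> \<open>The curvature contributes -g(X,Z). The term -g(X,Z) Q\<xi> / 2n contributes
    +g(X,Z) because Q\<xi> = -2n \<xi>, and g(\<xi>,Z) = 0 removes the rest.\<close>
  have "\<eta> p (W2_curv A n g D \<xi> X Z p) = 0"
    using n by (simp add: W2_curv_def eta_linear eta_riemann_curv_horizontal[OF X(1,2) Z(1,2)]
        g_xi Z(2) Qxi eta_xi)
  then have 2: "ricci A D \<xi> (W2_curv A n g D \<xi> X Z) p = 0"
    by (simp add: ricci_soliton[OF smooth_xi smooth_W2[OF smooth_xi X(1) Z(1)]] g_xi)
  have "k * (1 + k / (2 * real n)) = 0"
    using W2S[OF X(1) smooth_xi Z(1), of p] vw(3) by (simp add: 1 2)
  then have "k = 0 \<or> 1 + k / (2 * real n) = 0" by simp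
  then show ?thesis using n by (auto simp: k_def field_simps)
qed

end

end

theorem theorem3p12:
  fixes A :: "('a::{t2_space,second_countable_topology}, 'm::finite) chart set"
    and n :: nat
    and D :: "('a, 'm) connection"
    and \<phi> :: "('a, 'm) endofield"
    and \<xi> :: "('a, 'm) vfield"
    and \<eta> :: "('a, 'm) oneform"
    and g :: "('a, 'm) bilfield"
    and lam mu :: real
  assumes "n \<ge> 1" and "CARD('m) = 2 * n + 1"
    and "smooth_atlas A"
    and "para_kenmotsu A n D \<phi> \<xi> \<eta> g"
    and "eta_ricci_soliton A D \<xi> \<eta> g lam mu"
    and "\<And>X Y Z p. smooth_vf A X \<Longrightarrow> smooth_vf A Y \<Longrightarrow> smooth_vf A Z \<Longrightarrow>
           ricci A D (W2_curv A n g D \<xi> X Y) Z p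
         + ricci A D Y (W2_curv A n g D \<xi> X Z) p = 0"
  shows "(mu = 1 \<and> lam = 2 * real n - 1) \<or> (mu = 2 * real n + 1 \<and> lam = - 1)"
proof -
  interpret para_kenmotsu_manifold A n D \<phi> \<xi> \<eta> g
    by unfold_locales (fact assms)+
  have "lam + mu = 2 * real n"
    by (rule lam_plus_mu[OF assms(5)])
  moreover have "lam = 2 * real n - 1 \<or> lam = - 1"
    using W2_semisymmetric_constants[OF assms(5,1,6)] by auto
  ultimately show ?thesis by auto
qed

end
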